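(* Let $(X,\Sigma_X)$ and $(Y,\Sigma_Y)$ be measurable spaces, $\mu$ a probability measure on $X$, and $\mathcal{V}: X\times\Sigma_Y\to[0,1]$ a Markov kernel. Let $\mathcal{M}$ be the probability measure on $X\times Y$ defined by $\mathcal{M}(dq,dv)=\mathcal{V}(q,dv)\,\mu(dq)$. Fix $p\ge 1$ and, for each $j=0,1,\dots,p$, measurable mappings $S_j: X\times Y\to X\times Y$ and $\alpha_j: X\times Y\to[0,1]$. Consider the following statements: (H1) $S_j\circ S_j=I$ for every $j=0,1,\dots,p$. (H2) $\sum_{j=0}^p\int_Y\alpha_j(q,v)\,\mathcal{V}(q,dv)=1$ for every $q\in X$, and $$\sum_{j=0}^p\int_Y \alpha_j(S_j(q,v))\,S_j^*\mathcal{M}(dq,dv)=\mu(dq)$$ as measures on $X$. (H3) $\sum_{j=0}^p\int_Y\alpha_j(q,v)\,\mathcal{V}(q,dv)=1$ for every $q\in X$, and for every $j=0,1,\dots,p$, $$\alpha_j(S_j(q,v))\,S_j^*\mathcal{M}(dq,dv)=\alpha_j(q,v)\,\mathcal{M}(dq,dv)$$ as measures on $X\times Y$. Let $P^{\alpha,S,\mathcal{V}}$ be the Markov kernel $$P^{\alpha,S,\mathcal{V}}(q,d\tilde q)=\sum_{j=0}^p\int_Y\alpha_j(q,v)\,\delta_{\Pi_1 S_j(q,v)}(d\tilde q)\,\mathcal{V}(q,dv).$$ Then: (a) under (H1) and (H2), $\mu$ is invariant under $P^{\alpha,S,\mathcal{V}}$, i.e. $\mu P^{\alpha,S,\mathcal{V}}=\mu$;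 (b) (H3) implies (H2); (c) under (H1) and (H3), $P^{\alpha,S,\mathcal{V}}$ satisfies detailed balance with respect to $\mu$, i.e. $P^{\alpha,S,\mathcal{V}}(q,d\tilde q)\,\mu(dq)=P^{\alpha,S,\mathcal{V}}(\tilde q,dq)\,\mu(d\tilde q)$ as measures on $X\times X$.
   Context: A Markov kernel $\mathcal{V}:X\times\Sigma_Y\to[0,1]$ is a map such that $\mathcal{V}(q,\cdot)$ is a probability measure on $Y$ for each $q\in X$ and $q\mapsto\mathcal{V}(q,E)$ is measurable for each $E\in\Sigma_Y$. $\Pi_1:X\times Y\to X$ is the projection $\Pi_1(q,v)=q$. For a measurable map $\phi$ and a measure $\nu$, $\phi^*\nu$ denotes the pushforward: $\phi^*\nu(E)=\nu(\phi^{-1}(E))$. $\mu P(d\tilde q)=\int_X P(q,d\tilde q)\,\mu(dq)$. $\delta_x$ is the Dirac measure at $x$. $I$ is the identity map. *)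

theory Defs
  imports "HOL-Probability.Probability"
begin

text \<open>
  A Markov kernel from \<open>X\<close> to \<open>Y\<close> is an element of \<open>X \<rightarrow>\<^sub>M prob_algebra Y\<close>. The following lemma
  shows that this is the usual definition.
\<close>

lemma markov_kernel_iff:
  "V \<in> X \<rightarrow>\<^sub>M prob_algebra Y \<longleftrightarrow>
     (\<forall>q\<in>space X. prob_space (V q) \<and> sets (V q) = sets Y) \<and>
     (\<forall>E\<in>sets Y. (\<lambda>q. emeasure (V q) E) \<in> borel_measurable X)"
proof
  assume V: "V \<in> X \<rightarrow>\<^sub>M prob_algebra Y"
  then have "\<forall>q\<in>space X. V q \<in> space (prob_algebra Y)"
    by (auto dest: measurable_space)
  moreover have "V \<in> X \<rightarrow>\<^sub>M subprob_algebra Y"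
    using V by (rule measurable_prob_algebraD)
  ultimately show "(\<forall>q\<in>space X. prob_space (V q) \<and> sets (V q) = sets Y) \<and>
     (\<forall>E\<in>sets Y. (\<lambda>q. emeasure (V q) E) \<in> borel_measurable X)"
    by (auto simp: space_prob_algebra intro: measurable_emeasure_kernel)
next
  assume "(\<forall>q\<in>space X. prob_space (V q) \<and> sets (V q) = sets Y) \<and>
     (\<forall>E\<in>sets Y. (\<lambda>q. emeasure (V q) E) \<in> borel_measurable X)"
  then show "V \<in> X \<rightarrow>\<^sub>M prob_algebra Y"
    by (intro measurable_prob_algebraI measurable_subprob_algebra)
       (auto intro: prob_space_imp_subprob_space)
qed

text \<open>The measure \<open>K(q,dv) \<mu>(dq)\<close> on \<open>X \<times> Y\<close>.\<close>

definition joint :: "'x measure \<Rightarrow> 'y measure \<Rightarrow> 'x measure \<Rightarrow> ('x \<Rightarrow> 'y measure) \<Rightarrow> ('x \<times> 'y) measure"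
  where "joint X Y \<mu> K = \<mu> \<bind> (\<lambda>q. distr (K q) (X \<Otimes>\<^sub>M Y) (Pair q))"

lemma emeasure_joint:
  assumes "prob_space \<mu>" "sets \<mu> = sets X" "K \<in> X \<rightarrow>\<^sub>M prob_algebra Y" "E \<in> sets (X \<Otimes>\<^sub>M Y)"
  shows "emeasure (joint X Y \<mu> K) E = (\<integral>\<^sup>+q. (\<integral>\<^sup>+v. indicator E (q, v) \<partial>K q) \<partial>\<mu>)"
proof -
  have K: "K \<in> \<mu> \<rightarrow>\<^sub>M subprob_algebra Y"
    using assms(2,3) measurable_prob_algebraD measurable_cong_sets by blast
  have "(\<lambda>q. distr (K q) (X \<Otimes>\<^sub>M Y) (Pair q)) \<in> \<mu> \<rightarrow>\<^sub>M subprob_algebra (X \<Otimes>\<^sub>M Y)"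
  proof (rule measurable_distr2[OF _ K])
    show "case_prod Pair \<in> \<mu> \<Otimes>\<^sub>M Y \<rightarrow>\<^sub>M X \<Otimes>\<^sub>M Y"
      using measurable_ident_sets[OF sets_pair_measure_cong[OF assms(2) refl]] by (simp add: id_def)
  qed
  moreover have "space \<mu> \<noteq> {}"
    using assms(1) by (rule prob_space.not_empty)
  ultimately have "emeasure (joint X Y \<mu> K) E =
      (\<integral>\<^sup>+q. emeasure (distr (K q) (X \<Otimes>\<^sub>M Y) (Pair q)) E \<partial>\<mu>)"
    unfolding joint_def using assms(4) by (intro emeasure_bind)
  also have "\<dots> = (\<integral>\<^sup>+q. (\<integral>\<^sup>+v. indicator E (q, v) \<partial>K q) \<partial>\<mu>)"
  proof (rule nn_integral_cong)
    fix q assume q: "q \<in> space \<mu>"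
    then have s: "sets (K q) = sets Y"
      using K by (rule sets_kernel[rotated])
    have q': "q \<in> space X"
      using q sets_eq_imp_space_eq[OF assms(2)] by simp
    have P: "Pair q \<in> K q \<rightarrow>\<^sub>M X \<Otimes>\<^sub>M Y"
      using measurable_Pair1'[OF q', of Y] measurable_cong_sets[OF s refl] by blast
    have "emeasure (distr (K q) (X \<Otimes>\<^sub>M Y) (Pair q)) E
        = (\<integral>\<^sup>+z. indicator E z \<partial>distr (K q) (X \<Otimes>\<^sub>M Y) (Pair q))"
      using assms(4) by simp
    also have "\<dots> = (\<integral>\<^sup>+v. indicator E (q, v) \<partial>K q)"
      using assms(4) P by (subst nn_integral_distr) auto
    finally show "emeasure (distr (K q) (X \<Otimes>\<^sub>M Y) (Pair q)) E = (\<integral>\<^sup>+v. indicator E (q, v) \<partial>K q)" .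
  qed
  finally show ?thesis .
qed

definition transition ::
  "'x measure \<Rightarrow> nat \<Rightarrow> (nat \<Rightarrow> 'x \<times> 'y \<Rightarrow> real) \<Rightarrow> (nat \<Rightarrow> 'x \<times> 'y \<Rightarrow> 'x \<times> 'y) \<Rightarrow>
   ('x \<Rightarrow> 'y measure) \<Rightarrow> 'x \<Rightarrow> 'x measure"
  where "transition X p \<alpha> S V q = measure_of (space X) (sets X)
    (\<lambda>A. \<Sum>j\<le>p. \<integral>\<^sup>+v. ennreal (\<alpha> j (q, v)) * emeasure (return X (fst (S j (q, v)))) A \<partial>V q)"

definition normalized ::
  "'x measure \<Rightarrow> nat \<Rightarrow> (nat \<Rightarrow> 'x \<times> 'y \<Rightarrow> real) \<Rightarrow> ('x \<Rightarrow> 'y measure) \<Rightarrow> bool"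
  where "normalized X p \<alpha> V \<longleftrightarrow>
    (\<forall>q\<in>space X. (\<Sum>j\<le>p. \<integral>\<^sup>+v. ennreal (\<alpha> j (q, v)) \<partial>V q) = 1)"

definition cond_H1 ::
  "'x measure \<Rightarrow> 'y measure \<Rightarrow> nat \<Rightarrow> (nat \<Rightarrow> 'x \<times> 'y \<Rightarrow> 'x \<times> 'y) \<Rightarrow> bool"
  where "cond_H1 X Y p S \<longleftrightarrow> (\<forall>j\<le>p. \<forall>z\<in>space (X \<Otimes>\<^sub>M Y). S j (S j z) = z)"

text \<open>
  Integrating out the second variable is the pushforward under \<open>fst\<close>, and the sum of measures is
  taken setwise.
\<close>

definition cond_H2 ::
  "'x measure \<Rightarrow> 'y measure \<Rightarrow> 'x measure \<Rightarrow> ('x \<Rightarrow> 'y measure) \<Rightarrow> nat \<Rightarrow>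
   (nat \<Rightarrow> 'x \<times> 'y \<Rightarrow> 'x \<times> 'y) \<Rightarrow> (nat \<Rightarrow> 'x \<times> 'y \<Rightarrow> real) \<Rightarrow> bool"
  where "cond_H2 X Y \<mu> V p S \<alpha> \<longleftrightarrow> normalized X p \<alpha> V \<and>
    (\<forall>A\<in>sets X.
      (\<Sum>j\<le>p. emeasure (distr (density (distr (joint X Y \<mu> V) (X \<Otimes>\<^sub>M Y) (S j))
                                    (\<lambda>z. ennreal (\<alpha> j (S j z)))) X fst) A) = emeasure \<mu> A)"

definition cond_H3 ::
  "'x measure \<Rightarrow> 'y measure \<Rightarrow> 'x measure \<Rightarrow> ('x \<Rightarrow> 'y measure) \<Rightarrow> nat \<Rightarrow>
   (nat \<Rightarrow> 'x \<times> 'y \<Rightarrow> 'x \<times> 'y) \<Rightarrow> (nat \<Rightarrow> 'x \<times> 'y \<Rightarrow> real) \<Rightarrow> bool"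
  where "cond_H3 X Y \<mu> V p S \<alpha> \<longleftrightarrow> normalized X p \<alpha> V \<and>
    (\<forall>j\<le>p. density (distr (joint X Y \<mu> V) (X \<Otimes>\<^sub>M Y) (S j)) (\<lambda>z. ennreal (\<alpha> j (S j z)))
           = density (joint X Y \<mu> V) (\<lambda>z. ennreal (\<alpha> j z)))"

definition invariant_measure :: "'x measure \<Rightarrow> ('x \<Rightarrow> 'x measure) \<Rightarrow> bool"
  where "invariant_measure \<mu> P \<longleftrightarrow> \<mu> \<bind> P = \<mu>"

text \<open>\<open>P(q',dq) \<mu>(dq')\<close> is the image of \<open>P(q,dq') \<mu>(dq)\<close> under the exchange of the two variables.\<close>

definition detailed_balance :: "'x measure \<Rightarrow> 'x measure \<Rightarrow> ('x \<Rightarrow> 'x measure) \<Rightarrow> bool"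
  where "detailed_balance X \<mu> P \<longleftrightarrow>
    joint X X \<mu> P = distr (joint X X \<mu> P) (X \<Otimes>\<^sub>M X) (\<lambda>(q, q'). (q', q))"

text \<open>
  The set function in the definition of \<open>transition\<close> is indeed a measure, and it is a Markov kernel
  as soon as the weights are normalized; so neither \<open>measure_of\<close> nor \<open>\<bind>\<close> takes a default value.
\<close>

lemma
  assumes V: "V \<in> X \<rightarrow>\<^sub>M prob_algebra Y"
    and S: "\<And>j. j \<le> p \<Longrightarrow> S j \<in> X \<Otimes>\<^sub>M Y \<rightarrow>\<^sub>M X \<Otimes>\<^sub>M Y"
    and \<alpha>: "\<And>j. j \<le> p \<Longrightarrow> \<alpha> j \<in> borel_measurable (X \<Otimes>\<^sub>M Y)"
  shows emeasure_transition: "\<And>q A. q \<in> space X \<Longrightarrow> A \<in> sets X \<Longrightarrow>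
      emeasure (transition X p \<alpha> S V q) A =
        (\<Sum>j\<le>p. \<integral>\<^sup>+v. ennreal (\<alpha> j (q, v)) * emeasure (return X (fst (S j (q, v)))) A \<partial>V q)"
    and markov_transition: "normalized X p \<alpha> V \<Longrightarrow> transition X p \<alpha> S V \<in> X \<rightarrow>\<^sub>M prob_algebra X"
proof -
  note [measurable] = S \<alpha>
  have VS: "V \<in> X \<rightarrow>\<^sub>M subprob_algebra Y"
    using V by (rule measurable_prob_algebraD)
  let ?f = "\<lambda>q A. \<Sum>j\<le>p. \<integral>\<^sup>+v. ennreal (\<alpha> j (q, v)) * emeasure (return X (fst (S j (q, v)))) A \<partial>V q"
  have integrand: "(\<lambda>z. ennreal (\<alpha> j z) * emeasure (return X (fst (S j z))) A)
      \<in> borel_measurable (X \<Otimes>\<^sub>M Y)" if "A \<in> sets X" "j \<le> p" for A j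
  proof -
    note [measurable] = that
    show ?thesis by (simp add: that(1)) measurable
  qed
  have slice: "(\<lambda>v. ennreal (\<alpha> j (q, v)) * emeasure (return X (fst (S j (q, v)))) A)
      \<in> borel_measurable (V q)" if "A \<in> sets X" "q \<in> space X" "j \<le> p" for A q j
    using measurable_compose[OF measurable_Pair1'[OF that(2)] integrand[OF that(1,3)]]
      measurable_cong_sets[OF sets_kernel[OF VS that(2)] refl] by blast
  show em: "emeasure (transition X p \<alpha> S V q) A = ?f q A"
    if q: "q \<in> space X" and A: "A \<in> sets X" for q A
    unfolding transition_def
  proof (rule emeasure_measure_of_sigma[OF sets.sigma_algebra_axioms _ _ A])
    show "positive (sets X) (?f q)"
      by (simp add: positive_def)
    show "countably_additive (sets X) (?f q)"
    proof (rule countably_additiveI)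
      fix F :: "nat \<Rightarrow> _" assume F: "range F \<subseteq> sets X" "disjoint_family F" "\<Union> (range F) \<in> sets X"
      have "(\<Sum>i. ?f q (F i)) = (\<Sum>j\<le>p. \<Sum>i. \<integral>\<^sup>+v. ennreal (\<alpha> j (q, v)) *
                emeasure (return X (fst (S j (q, v)))) (F i) \<partial>V q)"
        by (subst suminf_sum) auto
      also have "\<dots> = ?f q (\<Union> (range F))"
      proof (rule sum.cong[OF refl])
        fix j assume j: "j \<in> {..p}"
        have "(\<Sum>i. \<integral>\<^sup>+v. ennreal (\<alpha> j (q, v)) * emeasure (return X (fst (S j (q, v)))) (F i) \<partial>V q)
          = (\<integral>\<^sup>+v. (\<Sum>i. ennreal (\<alpha> j (q, v)) * emeasure (return X (fst (S j (q, v)))) (F i)) \<partial>V q)"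
          using F j q by (intro nn_integral_suminf[symmetric] slice) auto
        also have "\<dots> = (\<integral>\<^sup>+v. ennreal (\<alpha> j (q, v)) *
                          emeasure (return X (fst (S j (q, v)))) (\<Union> (range F)) \<partial>V q)"
          using F by (intro nn_integral_cong) (subst ennreal_suminf_cmult, subst suminf_emeasure, auto)
        finally show "(\<Sum>i. \<integral>\<^sup>+v. ennreal (\<alpha> j (q, v)) *
            emeasure (return X (fst (S j (q, v)))) (F i) \<partial>V q) = \<dots>" .
      qed
      finally show "(\<Sum>i. ?f q (F i)) = ?f q (\<Union> (range F))" .
    qed
  qed
  assume norm: "normalized X p \<alpha> V"
  show "transition X p \<alpha> S V \<in> X \<rightarrow>\<^sub>M prob_algebra X"
    unfolding markov_kernel_iff
  proof (intro conjI ballI)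
    fix q assume q: "q \<in> space X"
    show s: "sets (transition X p \<alpha> S V q) = sets X"
      by (simp add: transition_def)
    have "emeasure (transition X p \<alpha> S V q) (space X) = (\<Sum>j\<le>p. \<integral>\<^sup>+v. ennreal (\<alpha> j (q, v)) \<partial>V q)"
      unfolding em[OF q sets.top]
    proof (intro sum.cong refl nn_integral_cong)
      fix j v assume "j \<in> {..p}" "v \<in> space (V q)"
      moreover from this have "(q, v) \<in> space (X \<Otimes>\<^sub>M Y)"
        using q sets_eq_imp_space_eq[OF sets_kernel[OF VS q]] by (simp add: space_pair_measure)
      ultimately have "S j (q, v) \<in> space (X \<Otimes>\<^sub>M Y)"
        using measurable_space[OF S] by auto
      then have "fst (S j (q, v)) \<in> space X"
        by (auto simp: space_pair_measure)
      then show "ennreal (\<alpha> j (q, v)) * emeasure (return X (fst (S j (q, v)))) (space X)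
          = ennreal (\<alpha> j (q, v))"
        by simp
    qed
    then show "prob_space (transition X p \<alpha> S V q)"
      using norm q sets_eq_imp_space_eq[OF s] by (intro prob_spaceI) (simp add: normalized_def)
  next
    fix A assume A: "A \<in> sets X"
    have "(\<lambda>q. ?f q A) \<in> borel_measurable X"
    proof (rule borel_measurable_sum)
      fix j assume "j \<in> {..p}"
      then show "(\<lambda>q. \<integral>\<^sup>+v. ennreal (\<alpha> j (q, v)) * emeasure (return X (fst (S j (q, v)))) A \<partial>V q)
          \<in> borel_measurable X"
        using integrand[OF A, of j]
        by (intro nn_integral_measurable_subprob_algebra2[OF _ VS]) (auto simp: case_prod_unfold)
    qed
    then show "(\<lambda>q. emeasure (transition X p \<alpha> S V q) A) \<in> borel_measurable X"
      by (subst measurable_cong[OF em[OF _ A]])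
  qed
qed

end

(* Substituting z \<mapsto> S j z, which is its own inverse, turns the mass that the j-th move
   carries to z, namely \<alpha> j (S j z) times the image of M under S j, into the weight \<alpha> j z of
   leaving z.  The law of (q, q') under one step of the chain is the sum over j of the images of
   \<alpha> j M under z \<mapsto> (fst z, fst (S j z)), so its second marginal is the left-hand side of
   (H2), and under (H3) each summand is symmetric. *)

theory Submission
  imports Defs
begin

section \<open>Integration against marginals and joint measures\<close>

lemma emeasure_marginal:
  fixes X :: "'x measure" and Y :: "'y measure"
  assumes M: "sets M = sets (X \<Otimes>\<^sub>M Y)" and A: "A \<in> sets X"
  shows "emeasure (distr M X fst) A = (\<integral>\<^sup>+z. indicator A (fst z) \<partial>M)"
proof -
  have fst: "fst \<in> M \<rightarrow>\<^sub>M X"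
    using measurable_fst measurable_cong_sets[OF M refl] by blast
  have "emeasure (distr M X fst) A = (\<integral>\<^sup>+q. indicator A q \<partial>distr M X fst)"
    using A by simp
  also have "\<dots> = (\<integral>\<^sup>+z. indicator A (fst z) \<partial>M)"
    using A by (intro nn_integral_distr fst) simp
  finally show ?thesis .
qed

context
  fixes X :: "'x measure" and Y :: "'y measure" and \<mu> :: "'x measure" and V :: "'x \<Rightarrow> 'y measure"
  assumes prob: "prob_space \<mu>" and sets_\<mu>: "sets \<mu> = sets X"
    and V: "V \<in> X \<rightarrow>\<^sub>M prob_algebra Y"
begin

lemma sets_joint: "sets (joint X Y \<mu> V) = sets (X \<Otimes>\<^sub>M Y)"
  \<comment> \<open>Over an empty space \<open>\<bind>\<close> takes a default value; a probability
    space is not empty, so the measurable sets are those of the measures being mixed.\<close>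
  unfolding joint_def using prob_space.not_empty[OF prob] by (intro sets_bind) auto

text \<open>Integrating against a bind integrates against each mixed measure first. Here that
  measure is the image of \<open>V q\<close> under \<open>Pair q\<close>, so a change of variables
  leaves the section of \<open>f\<close> at \<open>q\<close>.\<close>

lemma nn_integral_joint:
  assumes f: "f \<in> borel_measurable (X \<Otimes>\<^sub>M Y)"
  shows "(\<integral>\<^sup>+z. f z \<partial>joint X Y \<mu> V) = (\<integral>\<^sup>+q. (\<integral>\<^sup>+v. f (q, v) \<partial>V q) \<partial>\<mu>)"
proof -
  have V': "V \<in> \<mu> \<rightarrow>\<^sub>M subprob_algebra Y"
    using sets_\<mu> V measurable_prob_algebraD measurable_cong_sets by blast
  have "(\<lambda>q. distr (V q) (X \<Otimes>\<^sub>M Y) (Pair q)) \<in> \<mu> \<rightarrow>\<^sub>M subprob_algebra (X \<Otimes>\<^sub>M Y)"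
  proof (rule measurable_distr2[OF _ V'])
    \<comment> \<open>Uncurried, \<open>Pair\<close> is the identity, and \<mu> has the same
      measurable sets as \<open>X\<close>.\<close>
    show "case_prod Pair \<in> \<mu> \<Otimes>\<^sub>M Y \<rightarrow>\<^sub>M X \<Otimes>\<^sub>M Y"
      using measurable_ident_sets[OF sets_pair_measure_cong[OF sets_\<mu> refl]] by (simp add: id_def)
  qed
  then have "(\<integral>\<^sup>+z. f z \<partial>joint X Y \<mu> V) =
      (\<integral>\<^sup>+q. (\<integral>\<^sup>+z. f z \<partial>distr (V q) (X \<Otimes>\<^sub>M Y) (Pair q)) \<partial>\<mu>)"
    unfolding joint_def by (rule nn_integral_bind[OF f])
  also have "\<dots> = (\<integral>\<^sup>+q. (\<integral>\<^sup>+v. f (q, v) \<partial>V q) \<partial>\<mu>)"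
  proof (rule nn_integral_cong)
    fix q assume q: "q \<in> space \<mu>"
    then have q': "q \<in> space X"
      using sets_eq_imp_space_eq[OF sets_\<mu>] by simp
    have "Pair q \<in> V q \<rightarrow>\<^sub>M X \<Otimes>\<^sub>M Y"
      unfolding measurable_cong_sets[OF sets_kernel[OF V' q] refl] by (rule measurable_Pair1'[OF q'])
    then show "(\<integral>\<^sup>+z. f z \<partial>distr (V q) (X \<Otimes>\<^sub>M Y) (Pair q)) = (\<integral>\<^sup>+v. f (q, v) \<partial>V q)"
      using f by (simp add: nn_integral_distr)
  qed
  finally show ?thesis .
qed

text \<open>The density becomes a factor, the image measure substitutes \<open>T z\<close> for
  \<open>z\<close>, and the weight \<open>a (T (T z))\<close> collapses to \<open>a z\<close>. With
  \<open>f\<close> an indicator of \<open>fst z\<close> this rewrites the terms of (H2); with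
  \<open>f\<close> an indicator of \<open>(fst z, fst (T z))\<close> it interchanges the two ends of
  a move.\<close>

lemma nn_integral_density_distr_joint:
  assumes T: "T \<in> X \<Otimes>\<^sub>M Y \<rightarrow>\<^sub>M X \<Otimes>\<^sub>M Y"
    and inv: "\<And>z. z \<in> space (X \<Otimes>\<^sub>M Y) \<Longrightarrow> T (T z) = z"
    and a: "a \<in> borel_measurable (X \<Otimes>\<^sub>M Y)" and f: "f \<in> borel_measurable (X \<Otimes>\<^sub>M Y)"
  shows "(\<integral>\<^sup>+z. f z \<partial>density (distr (joint X Y \<mu> V) (X \<Otimes>\<^sub>M Y) T) (\<lambda>z. a (T z)))
    = (\<integral>\<^sup>+z. a z * f (T z) \<partial>joint X Y \<mu> V)"
proof -
  note [measurable] = T a f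
  have T': "T \<in> joint X Y \<mu> V \<rightarrow>\<^sub>M X \<Otimes>\<^sub>M Y"
    using T measurable_cong_sets[OF sets_joint refl] by blast
  have "(\<integral>\<^sup>+z. f z \<partial>density (distr (joint X Y \<mu> V) (X \<Otimes>\<^sub>M Y) T) (\<lambda>z. a (T z)))
      = (\<integral>\<^sup>+z. a (T z) * f z \<partial>distr (joint X Y \<mu> V) (X \<Otimes>\<^sub>M Y) T)"
    by (intro nn_integral_density) simp_all
  also have "\<dots> = (\<integral>\<^sup>+z. a (T (T z)) * f (T z) \<partial>joint X Y \<mu> V)"
    by (intro nn_integral_distr T') simp
  also have "\<dots> = (\<integral>\<^sup>+z. a z * f (T z) \<partial>joint X Y \<mu> V)"
    \<comment> \<open>The involution law holds on the product space only, which is the space of the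
      joint measure.\<close>
    by (intro nn_integral_cong) (simp add: inv sets_eq_imp_space_eq[OF sets_joint])
  finally show ?thesis .
qed

section \<open>The law of one step of the chain\<close>

context
  fixes p :: nat and S :: "nat \<Rightarrow> 'x \<times> 'y \<Rightarrow> 'x \<times> 'y" and \<alpha> :: "nat \<Rightarrow> 'x \<times> 'y \<Rightarrow> real"
  assumes S: "\<And>j. j \<le> p \<Longrightarrow> S j \<in> X \<Otimes>\<^sub>M Y \<rightarrow>\<^sub>M X \<Otimes>\<^sub>M Y"
    and \<alpha>: "\<And>j. j \<le> p \<Longrightarrow> \<alpha> j \<in> borel_measurable (X \<Otimes>\<^sub>M Y)"
begin

text \<open>The Dirac mass in the kernel turns the section of \<open>E\<close> at \<open>q\<close>
  into a condition on the endpoint \<open>fst (S j (q, v))\<close>; the finite sum then leaves the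
  outer integral, and each iterated integral is one against the joint measure. Rectangles
  \<open>E\<close> serve invariance, general \<open>E\<close> detailed balance.\<close>

lemma nn_integral_transition_section:
  assumes E: "E \<in> sets (X \<Otimes>\<^sub>M X)"
  shows "(\<integral>\<^sup>+q. emeasure (transition X p \<alpha> S V q) (Pair q -` E) \<partial>\<mu>) =
    (\<Sum>j\<le>p. \<integral>\<^sup>+z. ennreal (\<alpha> j z) * indicator E (fst z, fst (S j z)) \<partial>joint X Y \<mu> V)"
proof -
  note [measurable] = S \<alpha> E
  have f: "(\<lambda>z. ennreal (\<alpha> j z) * indicator E (fst z, fst (S j z))) \<in> borel_measurable (X \<Otimes>\<^sub>M Y)"
    if [measurable]: "j \<le> p" for j
    by measurable
  have "(\<integral>\<^sup>+q. emeasure (transition X p \<alpha> S V q) (Pair q -` E) \<partial>\<mu>) =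
      (\<integral>\<^sup>+q. (\<Sum>j\<le>p. \<integral>\<^sup>+v. ennreal (\<alpha> j (q, v)) * indicator E (q, fst (S j (q, v))) \<partial>V q) \<partial>\<mu>)"
  proof (rule nn_integral_cong)
    fix q assume "q \<in> space \<mu>"
    then have q: "q \<in> space X"
      using sets_eq_imp_space_eq[OF sets_\<mu>] by simp
    then show "emeasure (transition X p \<alpha> S V q) (Pair q -` E) =
        (\<Sum>j\<le>p. \<integral>\<^sup>+v. ennreal (\<alpha> j (q, v)) * indicator E (q, fst (S j (q, v))) \<partial>V q)"
      \<comment> \<open>A Dirac mass evaluates to an indicator on measurable sets, hence the
        measurability of the section of \<open>E\<close>; membership of a point in that section is
        membership of the pair in \<open>E\<close>.\<close>
      using emeasure_transition[OF V S \<alpha> q sets_Pair1[OF E]] sets_Pair1[OF E, of q]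
      by (simp add: indicator_def)
  qed
  also have "\<dots> =
      (\<Sum>j\<le>p. \<integral>\<^sup>+q. (\<integral>\<^sup>+v. ennreal (\<alpha> j (q, v)) * indicator E (q, fst (S j (q, v))) \<partial>V q) \<partial>\<mu>)"
  proof (rule nn_integral_sum)
    fix j assume "j \<in> {..p}"
    \<comment> \<open>Exchanging sum and integral requires the inner integrals to be measurable in
      \<open>q\<close>, which they are because \<open>V\<close> is a kernel.\<close>
    then have "(\<lambda>q. \<integral>\<^sup>+v. ennreal (\<alpha> j (q, v)) * indicator E (q, fst (S j (q, v))) \<partial>V q)
        \<in> borel_measurable X"
      using f[of j]
      by (intro nn_integral_measurable_subprob_algebra2[OF _ measurable_prob_algebraD[OF V]])
         (auto simp: case_prod_unfold)
    then show "(\<lambda>q. \<integral>\<^sup>+v. ennreal (\<alpha> j (q, v)) * indicator E (q, fst (S j (q, v))) \<partial>V q)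
        \<in> borel_measurable \<mu>"
      using measurable_cong_sets[OF sets_\<mu> refl] by blast
  qed
  also have "\<dots> =
      (\<Sum>j\<le>p. \<integral>\<^sup>+z. ennreal (\<alpha> j z) * indicator E (fst z, fst (S j z)) \<partial>joint X Y \<mu> V)"
    using nn_integral_joint[OF f] by (intro sum.cong) auto
  finally show ?thesis .
qed

text \<open>Normalization makes the transition a Markov kernel, so \<open>emeasure_joint\<close>
  applies to it, and its inner integral is the mass of a section of \<open>E\<close>.\<close>

lemma emeasure_joint_transition:
  assumes norm: "normalized X p \<alpha> V" and E: "E \<in> sets (X \<Otimes>\<^sub>M X)"
  shows "emeasure (joint X X \<mu> (transition X p \<alpha> S V)) E =
    (\<Sum>j\<le>p. \<integral>\<^sup>+z. ennreal (\<alpha> j z) * indicator E (fst z, fst (S j z)) \<partial>joint X Y \<mu> V)"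
proof -
  have "emeasure (joint X X \<mu> (transition X p \<alpha> S V)) E =
      (\<integral>\<^sup>+q. (\<integral>\<^sup>+q'. indicator (Pair q -` E) q' \<partial>transition X p \<alpha> S V q) \<partial>\<mu>)"
    using emeasure_joint[OF prob sets_\<mu> markov_transition[OF V S \<alpha> norm] E]
    by (simp add: indicator_def)
  also have "\<dots> = (\<integral>\<^sup>+q. emeasure (transition X p \<alpha> S V q) (Pair q -` E) \<partial>\<mu>)"
    using sets_Pair1[OF E] by (intro nn_integral_cong nn_integral_indicator) (simp add: transition_def)
  finally show ?thesis
    by (simp add: nn_integral_transition_section[OF E])
qed

section \<open>Invariance and detailed balance\<close>

text \<open>The mass that one step puts on \<open>A\<close> is a sum over the moves, and by the
  involution its \<open>j\<close>-th term is the \<open>j\<close>-th term of (H2), whose total is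
  the mass of \<open>A\<close> under \<mu>.\<close>

lemma invariant_measure_transition:
  assumes H1: "cond_H1 X Y p S" and H2: "cond_H2 X Y \<mu> V p S \<alpha>"
  shows "invariant_measure \<mu> (transition X p \<alpha> S V)"
  unfolding invariant_measure_def
proof (rule measure_eqI)
  let ?P = "transition X p \<alpha> S V" and ?M = "joint X Y \<mu> V"
  have norm: "normalized X p \<alpha> V"
    using H2 by (simp add: cond_H2_def)
  have P: "?P \<in> \<mu> \<rightarrow>\<^sub>M subprob_algebra X"
    unfolding measurable_cong_sets[OF sets_\<mu> refl]
    by (rule measurable_prob_algebraD[OF markov_transition[OF V S \<alpha> norm]])
  show s: "sets (\<mu> \<bind> ?P) = sets \<mu>"
    unfolding sets_\<mu> using prob_space.not_empty[OF prob]
    by (intro sets_bind) (auto simp: transition_def)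
  fix A assume "A \<in> sets (\<mu> \<bind> ?P)"
  then have A[measurable]: "A \<in> sets X"
    using s sets_\<mu> by simp
  have "emeasure (\<mu> \<bind> ?P) A = (\<integral>\<^sup>+q. emeasure (?P q) A \<partial>\<mu>)"
    by (rule emeasure_bind[OF prob_space.not_empty[OF prob] P A])
  \<comment> \<open>For \<open>q\<close> in the space, \<open>A\<close> is the section at
    \<open>q\<close> of the rectangle \<open>space X \<times> A\<close>, which brings the integral
    into the form of the section formula.\<close>
  also have "\<dots> = (\<integral>\<^sup>+q. emeasure (?P q) (Pair q -` (space X \<times> A)) \<partial>\<mu>)"
    by (intro nn_integral_cong arg_cong2[where f = emeasure])
       (auto simp: sets_eq_imp_space_eq[OF sets_\<mu>])
  also have "\<dots> = (\<Sum>j\<le>p. \<integral>\<^sup>+z. ennreal (\<alpha> j z) * indicator (space X \<times> A) (fst z, fst (S j z)) \<partial>?M)"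
    by (intro nn_integral_transition_section) simp
  also have "\<dots> = (\<Sum>j\<le>p. emeasure (distr (density (distr ?M (X \<Otimes>\<^sub>M Y) (S j))
      (\<lambda>z. ennreal (\<alpha> j (S j z)))) X fst) A)"
  proof (rule sum.cong[OF refl])
    fix j assume "j \<in> {..p}"
    then have j[measurable]: "j \<le> p"
      by simp
    note [measurable] = \<alpha>
    have "emeasure (distr (density (distr ?M (X \<Otimes>\<^sub>M Y) (S j)) (\<lambda>z. ennreal (\<alpha> j (S j z)))) X fst) A =
        (\<integral>\<^sup>+z. indicator A (fst z) \<partial>density (distr ?M (X \<Otimes>\<^sub>M Y) (S j)) (\<lambda>z. ennreal (\<alpha> j (S j z))))"
      by (intro emeasure_marginal A) simp
    also have "\<dots> = (\<integral>\<^sup>+z. ennreal (\<alpha> j z) * indicator A (fst (S j z)) \<partial>?M)"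
      using H1 j by (intro nn_integral_density_distr_joint S) (auto simp: cond_H1_def)
    \<comment> \<open>The factor \<open>space X\<close> imposes nothing, since \<open>fst z\<close>
      lies in it for every \<open>z\<close> of the product space.\<close>
    also have "\<dots> =
        (\<integral>\<^sup>+z. ennreal (\<alpha> j z) * indicator (space X \<times> A) (fst z, fst (S j z)) \<partial>?M)"
      by (intro nn_integral_cong)
         (auto simp: indicator_def sets_eq_imp_space_eq[OF sets_joint] space_pair_measure)
    finally show "(\<integral>\<^sup>+z. ennreal (\<alpha> j z) * indicator (space X \<times> A) (fst z, fst (S j z)) \<partial>?M) =
        emeasure (distr (density (distr ?M (X \<Otimes>\<^sub>M Y) (S j)) (\<lambda>z. ennreal (\<alpha> j (S j z)))) X fst) A"
      by simp
  qed
  also have "\<dots> = emeasure \<mu> A"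
    using H2 A by (simp add: cond_H2_def)
  finally show "emeasure (\<mu> \<bind> ?P) A = emeasure \<mu> A" .
qed

text \<open>By (H3) the \<open>j\<close>-th measure in (H2) has the same first marginal as the joint
  measure weighted by \<open>\<alpha> j\<close>. Summed over \<open>j\<close>, these weights have
  total mass 1 over each \<open>q\<close>, so the marginals add up to \<mu>.\<close>

lemma cond_H3_imp_cond_H2:
  assumes H3: "cond_H3 X Y \<mu> V p S \<alpha>"
  shows "cond_H2 X Y \<mu> V p S \<alpha>"
  unfolding cond_H2_def
proof (intro conjI ballI)
  let ?M = "joint X Y \<mu> V"
  show norm: "normalized X p \<alpha> V"
    using H3 by (simp add: cond_H3_def)
  fix A assume A[measurable]: "A \<in> sets X"
  note [measurable] = \<alpha>
  have "(\<Sum>j\<le>p. emeasure (distr (density (distr ?M (X \<Otimes>\<^sub>M Y) (S j))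
      (\<lambda>z. ennreal (\<alpha> j (S j z)))) X fst) A) =
      (\<Sum>j\<le>p. \<integral>\<^sup>+q. (\<integral>\<^sup>+v. ennreal (\<alpha> j (q, v)) * indicator A q \<partial>V q) \<partial>\<mu>)"
  proof (rule sum.cong[OF refl])
    fix j assume "j \<in> {..p}"
    then have j[measurable]: "j \<le> p"
      by simp
    have \<alpha>M: "(\<lambda>z. ennreal (\<alpha> j z)) \<in> borel_measurable ?M"
      and fM: "(\<lambda>z. indicator A (fst z) :: ennreal) \<in> borel_measurable ?M"
      unfolding measurable_cong_sets[OF sets_joint refl] by measurable
    have "emeasure (distr (density (distr ?M (X \<Otimes>\<^sub>M Y) (S j)) (\<lambda>z. ennreal (\<alpha> j (S j z)))) X fst) A =
        emeasure (distr (density ?M (\<lambda>z. ennreal (\<alpha> j z))) X fst) A"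
      using H3 j by (simp add: cond_H3_def)
    also have "\<dots> = (\<integral>\<^sup>+z. indicator A (fst z) \<partial>density ?M (\<lambda>z. ennreal (\<alpha> j z)))"
      by (intro emeasure_marginal A) (simp add: sets_joint)
    also have "\<dots> = (\<integral>\<^sup>+z. ennreal (\<alpha> j z) * indicator A (fst z) \<partial>?M)"
      by (rule nn_integral_density[OF \<alpha>M fM])
    also have "\<dots> = (\<integral>\<^sup>+q. (\<integral>\<^sup>+v. ennreal (\<alpha> j (q, v)) * indicator A q \<partial>V q) \<partial>\<mu>)"
      by (subst nn_integral_joint) auto
    finally show "emeasure (distr (density (distr ?M (X \<Otimes>\<^sub>M Y) (S j))
        (\<lambda>z. ennreal (\<alpha> j (S j z)))) X fst) A = \<dots>" .
  qed
  \<comment> \<open>The sum goes back under the outer integral because normalization is a statement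
    at each single \<open>q\<close>.\<close>
  also have "\<dots> = (\<integral>\<^sup>+q. (\<Sum>j\<le>p. \<integral>\<^sup>+v. ennreal (\<alpha> j (q, v)) * indicator A q \<partial>V q) \<partial>\<mu>)"
  proof (rule nn_integral_sum[symmetric])
    fix j assume "j \<in> {..p}"
    then have [measurable]: "j \<le> p"
      by simp
    have "(\<lambda>q. \<integral>\<^sup>+v. ennreal (\<alpha> j (q, v)) * indicator A q \<partial>V q) \<in> borel_measurable X"
      by (intro nn_integral_measurable_subprob_algebra2[OF _ measurable_prob_algebraD[OF V]]) measurable
    then show "(\<lambda>q. \<integral>\<^sup>+v. ennreal (\<alpha> j (q, v)) * indicator A q \<partial>V q) \<in> borel_measurable \<mu>"
      using measurable_cong_sets[OF sets_\<mu> refl] by blast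
  qed
  also have "\<dots> = (\<integral>\<^sup>+q. indicator A q \<partial>\<mu>)"
  proof (rule nn_integral_cong)
    fix q assume "q \<in> space \<mu>"
    then have "q \<in> space X"
      using sets_eq_imp_space_eq[OF sets_\<mu>] by simp
    then show "(\<Sum>j\<le>p. \<integral>\<^sup>+v. ennreal (\<alpha> j (q, v)) * indicator A q \<partial>V q) = indicator A q"
      \<comment> \<open>The indicator is constant in \<open>v\<close>: for \<open>q\<close> in
        \<open>A\<close> the sum is the normalization, otherwise every term vanishes.\<close>
      using norm by (cases "q \<in> A") (auto simp: normalized_def)
  qed
  also have "\<dots> = emeasure \<mu> A"
    by (simp add: sets_\<mu> A)
  finally show "(\<Sum>j\<le>p. emeasure (distr (density (distr ?M (X \<Otimes>\<^sub>M Y) (S j))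
      (\<lambda>z. ennreal (\<alpha> j (S j z)))) X fst) A) = emeasure \<mu> A" .
qed

text \<open>Each move is reversible by itself: (H3) replaces the weighted joint measure by its
  counterpart transported by \<open>S j\<close>, and the substitution
  \<open>z \<mapsto> S j z\<close> then exchanges the start \<open>fst z\<close> with the endpoint
  \<open>fst (S j z)\<close>.\<close>

lemma detailed_balance_transition:
  assumes H1: "cond_H1 X Y p S" and H3: "cond_H3 X Y \<mu> V p S \<alpha>"
  shows "detailed_balance X \<mu> (transition X p \<alpha> S V)"
  unfolding detailed_balance_def
proof (rule measure_eqI)
  let ?J = "joint X X \<mu> (transition X p \<alpha> S V)" and ?M = "joint X Y \<mu> V"
  let ?swap = "\<lambda>(q, q'). (q', q)"
  have norm: "normalized X p \<alpha> V"
    using H3 by (simp add: cond_H3_def)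
  have sets_J: "sets ?J = sets (X \<Otimes>\<^sub>M X)"
    unfolding joint_def using prob_space.not_empty[OF prob] by (intro sets_bind) auto
  then show "sets ?J = sets (distr ?J (X \<Otimes>\<^sub>M X) ?swap)"
    by simp
  fix E assume "E \<in> sets ?J"
  then have E[measurable]: "E \<in> sets (X \<Otimes>\<^sub>M X)"
    by (simp add: sets_J)
  have swap: "?swap \<in> X \<Otimes>\<^sub>M X \<rightarrow>\<^sub>M X \<Otimes>\<^sub>M X"
    by measurable
  have swap': "?swap \<in> ?J \<rightarrow>\<^sub>M X \<Otimes>\<^sub>M X"
    using swap measurable_cong_sets[OF sets_J refl] by blast
  \<comment> \<open>The transposed event, cut down to the space so that it is measurable and has the
    form in which \<open>emeasure_distr\<close> gives the mass of an image measure.\<close>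
  let ?E' = "?swap -` E \<inter> space (X \<Otimes>\<^sub>M X)"
  have "emeasure ?J E =
      (\<Sum>j\<le>p. \<integral>\<^sup>+z. ennreal (\<alpha> j z) * indicator E (fst z, fst (S j z)) \<partial>?M)"
    by (rule emeasure_joint_transition[OF norm E])
  also have "\<dots> = (\<Sum>j\<le>p. \<integral>\<^sup>+z. ennreal (\<alpha> j z) * indicator ?E' (fst z, fst (S j z)) \<partial>?M)"
  proof (rule sum.cong[OF refl])
    fix j assume "j \<in> {..p}"
    then have j[measurable]: "j \<le> p"
      by simp
    note [measurable] = S \<alpha>
    have f: "(\<lambda>z. indicator E (fst z, fst (S j z)) :: ennreal) \<in> borel_measurable (X \<Otimes>\<^sub>M Y)"
      by measurable
    have \<alpha>M: "(\<lambda>z. ennreal (\<alpha> j z)) \<in> borel_measurable ?M"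
      and fM: "(\<lambda>z. indicator E (fst z, fst (S j z)) :: ennreal) \<in> borel_measurable ?M"
      unfolding measurable_cong_sets[OF sets_joint refl] by measurable
    have "(\<integral>\<^sup>+z. ennreal (\<alpha> j z) * indicator E (fst z, fst (S j z)) \<partial>?M) =
        (\<integral>\<^sup>+z. indicator E (fst z, fst (S j z)) \<partial>density ?M (\<lambda>z. ennreal (\<alpha> j z)))"
      by (rule nn_integral_density[OF \<alpha>M fM, symmetric])
    \<comment> \<open>(H3) is read from right to left here, which prepares the substitution.\<close>
    also have "\<dots> = (\<integral>\<^sup>+z. indicator E (fst z, fst (S j z))
        \<partial>density (distr ?M (X \<Otimes>\<^sub>M Y) (S j)) (\<lambda>z. ennreal (\<alpha> j (S j z))))"
      using H3 j by (simp add: cond_H3_def)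
    also have "\<dots> = (\<integral>\<^sup>+z. ennreal (\<alpha> j z) * indicator E (fst (S j z), fst (S j (S j z))) \<partial>?M)"
      using H1 j by (intro nn_integral_density_distr_joint S f) (auto simp: cond_H1_def)
    also have "\<dots> = (\<integral>\<^sup>+z. ennreal (\<alpha> j z) * indicator ?E' (fst z, fst (S j z)) \<partial>?M)"
    proof (rule nn_integral_cong)
      fix z assume "z \<in> space ?M"
      then have z: "z \<in> space (X \<Otimes>\<^sub>M Y)"
        by (simp add: sets_eq_imp_space_eq[OF sets_joint])
      \<comment> \<open>Membership in the space accounts for the intersection in \<open>?E'\<close>;
        the rest is \<open>S j (S j z) = z\<close>.\<close>
      then have "(fst z, fst (S j z)) \<in> space (X \<Otimes>\<^sub>M X)"
        using measurable_space[OF S[OF j] z] by (auto simp: space_pair_measure)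
      then show "ennreal (\<alpha> j z) * indicator E (fst (S j z), fst (S j (S j z))) =
          ennreal (\<alpha> j z) * indicator ?E' (fst z, fst (S j z))"
        using H1 j z by (simp add: cond_H1_def indicator_def)
    qed
    finally show "(\<integral>\<^sup>+z. ennreal (\<alpha> j z) * indicator E (fst z, fst (S j z)) \<partial>?M) = \<dots>" .
  qed
  \<comment> \<open>The one-step formula, read backwards for the transposed event.\<close>
  also have "\<dots> = emeasure ?J ?E'"
    by (rule emeasure_joint_transition[OF norm measurable_sets[OF swap E], symmetric])
  also have "\<dots> = emeasure (distr ?J (X \<Otimes>\<^sub>M X) ?swap) E"
    by (simp only: emeasure_distr[OF swap' E] sets_eq_imp_space_eq[OF sets_J])
  finally show "emeasure ?J E = emeasure (distr ?J (X \<Otimes>\<^sub>M X) ?swap) E" .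
qed

end

end

theorem theorem2p2:
  fixes X :: "'x measure" and Y :: "'y measure" and \<mu> :: "'x measure"
    and V :: "'x \<Rightarrow> 'y measure" and p :: nat
    and S :: "nat \<Rightarrow> 'x \<times> 'y \<Rightarrow> 'x \<times> 'y"
    and \<alpha> :: "nat \<Rightarrow> 'x \<times> 'y \<Rightarrow> real"
  assumes "prob_space \<mu>" and "sets \<mu> = sets X"
    and "V \<in> X \<rightarrow>\<^sub>M prob_algebra Y"
    and "p \<ge> 1"
    and "\<And>j. j \<le> p \<Longrightarrow> S j \<in> X \<Otimes>\<^sub>M Y \<rightarrow>\<^sub>M X \<Otimes>\<^sub>M Y"
    and "\<And>j. j \<le> p \<Longrightarrow> \<alpha> j \<in> borel_measurable (X \<Otimes>\<^sub>M Y)"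
    and "\<And>j z. j \<le> p \<Longrightarrow> z \<in> space (X \<Otimes>\<^sub>M Y) \<Longrightarrow> 0 \<le> \<alpha> j z \<and> \<alpha> j z \<le> 1"
  shows "(cond_H1 X Y p S \<and> cond_H2 X Y \<mu> V p S \<alpha> \<longrightarrow>
            invariant_measure \<mu> (transition X p \<alpha> S V))
       \<and> (cond_H3 X Y \<mu> V p S \<alpha> \<longrightarrow> cond_H2 X Y \<mu> V p S \<alpha>)
       \<and> (cond_H1 X Y p S \<and> cond_H3 X Y \<mu> V p S \<alpha> \<longrightarrow>
            detailed_balance X \<mu> (transition X p \<alpha> S V))"
proof (intro conjI impI; (elim conjE)?)
  assume "cond_H1 X Y p S" "cond_H2 X Y \<mu> V p S \<alpha>"
  with assms show "invariant_measure \<mu> (transition X p \<alpha> S V)"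
    by (intro invariant_measure_transition)
next
  assume "cond_H3 X Y \<mu> V p S \<alpha>"
  with assms show "cond_H2 X Y \<mu> V p S \<alpha>"
    by (intro cond_H3_imp_cond_H2)
next
  assume "cond_H1 X Y p S" "cond_H3 X Y \<mu> V p S \<alpha>"
  with assms show "detailed_balance X \<mu> (transition X p \<alpha> S V)"
    by (intro detailed_balance_transition)
qed

end
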